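(* For any normal modal logic $L_0$ and $L\in\mathsf{NExt}\,L_0$, the degree of fmp of $L$ in $\mathsf{NExt}\,L_0$ is either $\leq\aleph_0$ or $2^{\aleph_0}$.
   Context: We work in ZFC (no Continuum Hypothesis). Modal formulas are generated from a countable set $\mathsf{Prop}$ of propositional variables by $\phi::=p\mid\bot\mid\phi\land\psi\mid\phi\to\psi\mid\Box\phi$. A normal modal logic is a set of formulas containing all propositional tautologies and $\Box(p\to q)\to\Box p\to\Box q$, and closed under modus ponens, necessitation and uniform substitution. $\mathsf{NExt}\,L_0$ is the set of normal modal logics $L$ with $L_0\subseteq L$. A Kripke frame $\mathcal{F}=(F,R)$ is a nonempty set $F$ with a binary relation $R\subseteq F\times F$. A valuation $V:\mathsf{Prop}\to\mathcal{P}(F)$ extends to all formulas, with Boolean connectives interpreted by Boolean operations and $V(\Box\phi)=\{x\in F:\forall y\,(Rxy\to y\in V(\phi))\}$. $\mathcal{F}\models\phi$ means $V(\phi)=F$ for all valuations $V$, and $\mathcal{F}\models L$ means $\mathcal{F}\models\phi$ for all $\phi\in L$. Let $\mathsf{FFr}$ be the class of all finite Kripke frames and $\mathsf{FFr}(L)=\{\mathcal{F}\in\mathsf{FFr}:\mathcal{F}\models L\}$. The fmp span of $L$ in $\mathsf{NExt}\,L_0$ is $\mathrm{fmp}_{L_0}(L)=\{L'\in\mathsf{NExt}\,L_0:\mathsf{FFr}(L')=\mathsf{FFr}(L)\}$, and the degree of fmp (finite model property) of $L$ in $\mathsf{NExt}\,L_0$ is the cardinality of $\mathrm{fmp}_{L_0}(L)$.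 *)

theory Defs
  imports Main "HOL-Library.Countable"
begin

unbundle cardinal_syntax

datatype 'p fm =
    Var 'p
  | Bot ("\<^bold>\<bottom>")
  | And "'p fm" "'p fm" (infixr "\<^bold>\<and>" 65)
  | Imp "'p fm" "'p fm" (infixr "\<^bold>\<rightarrow>" 55)
  | Box "'p fm" ("\<^bold>\<box> _" [80] 80)

primrec subst :: "('p \<Rightarrow> 'p fm) \<Rightarrow> 'p fm \<Rightarrow> 'p fm" where
  "subst s (Var p) = s p"
| "subst s \<^bold>\<bottom> = \<^bold>\<bottom>"
| "subst s (\<phi> \<^bold>\<and> \<psi>) = subst s \<phi> \<^bold>\<and> subst s \<psi>"
| "subst s (\<phi> \<^bold>\<rightarrow> \<psi>) = subst s \<phi> \<^bold>\<rightarrow> subst s \<psi>"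
| "subst s (\<^bold>\<box> \<phi>) = \<^bold>\<box> (subst s \<phi>)"

text \<open>Boolean evaluation in which variables (via \<open>a\<close>) and boxed formulas (via \<open>b\<close>) are both
  treated as atoms, so that instances such as \<open>\<box>p \<rightarrow> \<box>p\<close> count as propositional tautologies.\<close>

primrec beval :: "('p \<Rightarrow> bool) \<Rightarrow> ('p fm \<Rightarrow> bool) \<Rightarrow> 'p fm \<Rightarrow> bool" where
  "beval a b (Var p) = a p"
| "beval a b \<^bold>\<bottom> = False"
| "beval a b (\<phi> \<^bold>\<and> \<psi>) = (beval a b \<phi> \<and> beval a b \<psi>)"
| "beval a b (\<phi> \<^bold>\<rightarrow> \<psi>) = (beval a b \<phi> \<longrightarrow> beval a b \<psi>)"
| "beval a b (\<^bold>\<box> \<phi>) = b \<phi>"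

definition tautology :: "'p fm \<Rightarrow> bool" where
  "tautology \<phi> \<longleftrightarrow> (\<forall>a b. beval a b \<phi>)"

text \<open>The distribution axiom is given for all formulas \<open>\<phi>\<close>, \<open>\<psi>\<close>. By closure under substitution
  this amounts to its instance for two distinct variables, but it also makes sense when the type
  of variables has only one element.\<close>

definition normal_logic :: "'p fm set \<Rightarrow> bool" where
  "normal_logic L \<longleftrightarrow>
     (\<forall>\<phi>. tautology \<phi> \<longrightarrow> \<phi> \<in> L) \<and>
     (\<forall>\<phi> \<psi>. \<^bold>\<box> (\<phi> \<^bold>\<rightarrow> \<psi>) \<^bold>\<rightarrow> \<^bold>\<box> \<phi> \<^bold>\<rightarrow> \<^bold>\<box> \<psi> \<in> L) \<and>
     (\<forall>\<phi> \<psi>. \<phi> \<^bold>\<rightarrow> \<psi> \<in> L \<longrightarrow> \<phi> \<in> L \<longrightarrow> \<psi> \<in> L) \<and>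
     (\<forall>\<phi>. \<phi> \<in> L \<longrightarrow> \<^bold>\<box> \<phi> \<in> L) \<and>
     (\<forall>\<phi> s. \<phi> \<in> L \<longrightarrow> subst s \<phi> \<in> L)"

definition NExt :: "'p fm set \<Rightarrow> 'p fm set set" where
  "NExt L\<^sub>0 = {L. normal_logic L \<and> L\<^sub>0 \<subseteq> L}"

type_synonym 'w kframe = "'w set \<times> ('w \<times> 'w) set"

definition kripke_frame :: "'w kframe \<Rightarrow> bool" where
  "kripke_frame \<F> \<longleftrightarrow> fst \<F> \<noteq> {} \<and> snd \<F> \<subseteq> fst \<F> \<times> fst \<F>"

primrec truth_set :: "'w kframe \<Rightarrow> ('p \<Rightarrow> 'w set) \<Rightarrow> 'p fm \<Rightarrow> 'w set" where
  "truth_set \<F> V (Var p) = V p"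
| "truth_set \<F> V \<^bold>\<bottom> = {}"
| "truth_set \<F> V (\<phi> \<^bold>\<and> \<psi>) = truth_set \<F> V \<phi> \<inter> truth_set \<F> V \<psi>"
| "truth_set \<F> V (\<phi> \<^bold>\<rightarrow> \<psi>) = (fst \<F> - truth_set \<F> V \<phi>) \<union> truth_set \<F> V \<psi>"
| "truth_set \<F> V (\<^bold>\<box> \<phi>) = {x \<in> fst \<F>. \<forall>y. (x, y) \<in> snd \<F> \<longrightarrow> y \<in> truth_set \<F> V \<phi>}"

definition valid :: "'w kframe \<Rightarrow> 'p fm \<Rightarrow> bool" (infix "\<Turnstile>" 50) where
  "\<F> \<Turnstile> \<phi> \<longleftrightarrow> (\<forall>V. (\<forall>p. V p \<subseteq> fst \<F>) \<longrightarrow> truth_set \<F> V \<phi> = fst \<F>)"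

text \<open>The finite frames form a proper class; we take those whose worlds are natural numbers.
  Every finite frame, over any type of worlds, is isomorphic to one of these and hence validates the
  same formulas as it does (see \<open>finite_frame_nat_copy\<close> below), so that equality of the sets
  \<open>FFr L\<close> and \<open>FFr L'\<close> is the same as equality of the corresponding classes.\<close>

definition FFr :: "'p fm set \<Rightarrow> nat kframe set" where
  "FFr L = {\<F>. kripke_frame \<F> \<and> finite (fst \<F>) \<and> (\<forall>\<phi>\<in>L. \<F> \<Turnstile> \<phi>)}"

definition fmp_span :: "'p fm set \<Rightarrow> 'p fm set \<Rightarrow> 'p fm set set" where
  "fmp_span L\<^sub>0 L = {L' \<in> NExt L\<^sub>0. FFr L' = FFr L}"

definition degree_of_fmp :: "'p fm set \<Rightarrow> 'p fm set \<Rightarrow> 'p fm set rel" where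
  "degree_of_fmp L\<^sub>0 L = |fmp_span L\<^sub>0 L|"

lemma truth_set_subset:
  assumes "\<And>p. V p \<subseteq> fst \<F>"
  shows "truth_set \<F> V \<phi> \<subseteq> fst \<F>"
  using assms by (induction \<phi>) auto

lemma truth_set_image:
  assumes inj: "inj_on f F" and R: "R \<subseteq> F \<times> F" and V: "\<And>p. V p \<subseteq> F"
  shows "truth_set (f ` F, map_prod f f ` R) (\<lambda>p. f ` V p) \<phi> = f ` truth_set (F, R) V \<phi>"
proof (induction \<phi>)
  have sub: "truth_set (F, R) V \<chi> \<subseteq> F" for \<chi> :: "'c fm"
    using truth_set_subset[of V "(F, R)"] V by simp
  {
    case (And \<phi> \<psi>)
    then show ?case using inj_on_image_Int[OF inj sub sub] by simp
  next
    case (Imp \<phi> \<psi>)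
    then show ?case
      using inj_on_image_set_diff[OF inj, of F "truth_set (F, R) V \<phi>"] sub[of \<phi>]
      by (simp add: image_Un)
  next
    case (Box \<phi>)
    have mem: "f y \<in> f ` truth_set (F, R) V \<phi> \<longleftrightarrow> y \<in> truth_set (F, R) V \<phi>" if "y \<in> F" for y
      using inj_on_image_mem_iff[OF inj that sub] .
    have "(\<forall>z. (f x, z) \<in> map_prod f f ` R \<longrightarrow> z \<in> f ` truth_set (F, R) V \<phi>) \<longleftrightarrow>
      (\<forall>y. (x, y) \<in> R \<longrightarrow> y \<in> truth_set (F, R) V \<phi>)" (is "?l \<longleftrightarrow> ?r") if x: "x \<in> F" for x
    proof
      assume ?l
      show ?r
      proof (intro allI impI)
        fix y assume xy: "(x, y) \<in> R"
        have "(f x, f y) \<in> map_prod f f ` R" using xy by (rule map_prod_imageI)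
        then show "y \<in> truth_set (F, R) V \<phi>" using \<open>?l\<close> mem[of y] R xy by blast
      qed
    next
      assume ?r
      show ?l
      proof (intro allI impI)
        fix z assume "(f x, z) \<in> map_prod f f ` R"
        then obtain x' y where "(x', y) \<in> R" "f x = f x'" "z = f y" by auto
        moreover from this have "x' = x" using inj_onD[OF inj] R x by blast
        ultimately show "z \<in> f ` truth_set (F, R) V \<phi>" using \<open>?r\<close> by blast
      qed
    qed
    moreover have "{z \<in> f ` F. P z} = f ` {x \<in> F. P (f x)}" for P by auto
    ultimately show ?case unfolding truth_set.simps Box fst_conv snd_conv by (simp cong: conj_cong)
  }
qed auto

lemma valid_image:
  fixes f :: "'w \<Rightarrow> 'v" and \<phi> :: "'p fm"
  assumes inj: "inj_on f F" and R: "R \<subseteq> F \<times> F"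
  shows "(f ` F, map_prod f f ` R) \<Turnstile> \<phi> \<longleftrightarrow> (F, R) \<Turnstile> \<phi>"
proof
  assume *: "(f ` F, map_prod f f ` R) \<Turnstile> \<phi>"
  show "(F, R) \<Turnstile> \<phi>" unfolding valid_def
  proof (intro allI impI)
    fix V :: "'p \<Rightarrow> 'w set" assume V: "\<forall>p. V p \<subseteq> fst (F, R)"
    have "f ` truth_set (F, R) V \<phi> = f ` F"
      using * V truth_set_image[OF inj R, of V \<phi>] unfolding valid_def
      by (metis fst_conv image_mono)
    then show "truth_set (F, R) V \<phi> = fst (F, R)"
      using inj_on_image_eq_iff[OF inj] truth_set_subset[of V "(F, R)" \<phi>] V by simp
  qed
next
  assume *: "(F, R) \<Turnstile> \<phi>"
  show "(f ` F, map_prod f f ` R) \<Turnstile> \<phi>" unfolding valid_def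
  proof (intro allI impI)
    fix W :: "'p \<Rightarrow> 'v set" assume W: "\<forall>p. W p \<subseteq> fst (f ` F, map_prod f f ` R)"
    define V where "V p = {x \<in> F. f x \<in> W p}" for p
    have "W = (\<lambda>p. f ` V p)" using W by (fastforce simp: V_def)
    moreover have V: "V p \<subseteq> F" for p by (auto simp: V_def)
    ultimately show "truth_set (f ` F, map_prod f f ` R) W \<phi> = fst (f ` F, map_prod f f ` R)"
      using * truth_set_image[of f F R V \<phi>, OF inj R V] unfolding valid_def by simp
  qed
qed

lemma finite_frame_nat_copy:
  fixes \<F> :: "'w kframe"
  assumes "kripke_frame \<F>" "finite (fst \<F>)"
  obtains \<G> :: "nat kframe" and f :: "'w \<Rightarrow> nat"
  where "bij_betw f (fst \<F>) (fst \<G>)" "snd \<G> = map_prod f f ` snd \<F>"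
    "kripke_frame \<G>" "finite (fst \<G>)" "\<And>\<phi> :: 'p fm. \<G> \<Turnstile> \<phi> \<longleftrightarrow> \<F> \<Turnstile> \<phi>"
proof -
  obtain F R where FR: "\<F> = (F, R)" by force
  obtain f :: "'w \<Rightarrow> nat" where f: "inj_on f F"
    using assms(2) finite_imp_inj_to_nat_seg[of F] FR by auto
  have R: "R \<subseteq> F \<times> F" using assms(1) FR by (simp add: kripke_frame_def)
  show thesis
  proof (rule that[of f "(f ` F, map_prod f f ` R)"])
    show "kripke_frame (f ` F, map_prod f f ` R)"
      using assms(1) R FR by (auto simp: kripke_frame_def)
  qed (use assms(2) f FR valid_image[OF f R] in \<open>auto simp: bij_betw_def\<close>)
qed

end

theory Submission
  imports Defs "HOL-Analysis.Urysohn"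
begin

text \<open>
  A logic is a set of formulas, hence a point of the Cantor space \<open>2\<^sup>F\<close>, where \<open>F\<close> is the countable
  set of formulas. The conditions defining the fmp span of \<open>L\<close> have low topological complexity.
  Being a normal logic that contains \<open>L\<^sub>0\<close> is a closed condition, since it consists of implications
  between finitely many membership statements. Having the same finite frames as \<open>L\<close> is one condition
  for each of the countably many finite frames on natural numbers: if the frame validates \<open>L\<close>, all
  formulas that it refutes must be avoided, which is a closed condition; if it refutes \<open>L\<close>, some
  formula that it refutes must be present, which is an open condition. So the span is a
  \<open>G\<^sub>\<delta>\<close> set (\<open>gdelta_in_fmp_span\<close>).

  A \<open>G\<^sub>\<delta>\<close> subset of a Polish space is Polish itself, and if it is uncountable, its condensation
  points form a nonempty perfect set, which has at least the size of the continuum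
  (\<open>uncountable_gdelta_in_reals_lepoll\<close>). Conversely there are only \<open>2\<^bsup>\<aleph>\<^sub>0\<^esup>\<close> sets of formulas.
\<close>

(* Set_Algebras uses =o for membership, which would make every equation of cardinals ambiguous *)
no_notation elt_set_eq (infix "=o" 50)

section \<open>Uncountable \<open>G\<^sub>\<delta>\<close> sets\<close>

text \<open>
  The Cantor--Bendixson argument: removing all countable members of a countable base from \<open>S\<close>
  removes only countably many points. What remains is closed in \<open>S\<close>, and each of its points is a
  condensation point, so it has no isolated points.
\<close>
lemma uncountable_gdelta_in_reals_lepoll:
  assumes X: "completely_metrizable_space X" "second_countable X"
    and S: "gdelta_in X S" "uncountable S"
  shows "(UNIV :: real set) \<lesssim> S"
proof -
  define Y where "Y = subtopology X S"
  have Y: "completely_metrizable_space Y" "second_countable Y"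
    using completely_metrizable_space_gdelta_in second_countable_subtopology X S
    by (auto simp: Y_def)
  have top: "topspace Y = S"
    using gdelta_in_subset[OF S(1)] by (auto simp: Y_def)
  obtain \<B> where \<B>: "countable \<B>" "\<And>V. V \<in> \<B> \<Longrightarrow> openin Y V"
    "\<And>U x. openin Y U \<Longrightarrow> x \<in> U \<Longrightarrow> \<exists>V\<in>\<B>. x \<in> V \<and> V \<subseteq> U"
    using Y(2) unfolding second_countable_def by metis
  define N where "N = \<Union>{V \<in> \<B>. countable V}"
  have "countable (\<Union>V\<in>{V \<in> \<B>. countable V}. V)"
    using \<B>(1) by (intro countable_UN) auto
  then have N: "countable N"
    by (simp add: N_def)
  have "Y derived_set_of (S - N) = S - N"
  proof (intro equalityI subsetI)
    fix x assume x: "x \<in> Y derived_set_of (S - N)"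
    have "x \<notin> N"
    proof
      assume "x \<in> N"
      then obtain V where V: "V \<in> \<B>" "countable V" "x \<in> V" by (auto simp: N_def)
      then have "V \<subseteq> N" by (auto simp: N_def)
      with x V \<B>(2)[OF V(1)] show False by (auto simp: in_derived_set_of)
    qed
    with x show "x \<in> S - N" by (auto simp: in_derived_set_of top)
  next
    fix x assume x: "x \<in> S - N"
    have "\<exists>y. y \<noteq> x \<and> y \<in> S - N \<and> y \<in> U" if U: "x \<in> U" "openin Y U" for U
    proof -
      obtain V where V: "V \<in> \<B>" "x \<in> V" "V \<subseteq> U" using \<B>(3) U by blast
      with x have "uncountable V" by (auto simp: N_def)
      then have "uncountable (V - insert x N)" using N by (simp add: uncountable_minus_countable)
      then obtain y where "y \<in> V - insert x N" by (metis countable_empty equals0I)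
      with V openin_subset[OF U(2)] show ?thesis by (auto simp: top)
    qed
    with x show "x \<in> Y derived_set_of (S - N)" by (auto simp: in_derived_set_of top)
  qed
  moreover have "S - N \<noteq> {}"
    using S(2) N countable_subset by auto
  ultimately have "(UNIV :: real set) \<lesssim> S - N"
    using lepoll_perfect_set Y(1) by blast
  then show ?thesis
    by (meson Diff_subset lepoll_trans subset_imp_lepoll)
qed

section \<open>The space of predicates on a countable type\<close>

instance bool :: second_countable_topology
proof
  show "\<exists>B :: bool set set. countable B \<and> open = generate_topology B"
    by (intro exI[of _ "range lessThan \<union> range greaterThan"]) (auto simp: open_bool_def)
qed

lemma completely_metrizable_space_predicates:
  "completely_metrizable_space (euclidean :: ('a::countable \<Rightarrow> bool) topology)"
proof -
  have "completely_metrizable_space (euclidean :: bool topology)"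
    using completely_metrizable_space_discrete_topology discrete_topology_unique open_discrete
    by (metis open_openin topspace_euclidean)
  then show ?thesis
    unfolding euclidean_product_topology[symmetric]
    by (simp add: completely_metrizable_space_product_topology)
qed

lemma closed_imp_gdelta_in_predicates:
  fixes S :: "('a::countable \<Rightarrow> bool) set"
  assumes "closed S"
  shows "gdelta_in euclidean S"
  using assms closed_imp_gdelta_in completely_metrizable_imp_metrizable_space
    completely_metrizable_space_predicates closed_closedin by metis

lemma second_countable_euclidean:
  "second_countable (euclidean :: 'a::second_countable_topology topology)"
proof -
  obtain \<B> :: "'a set set" where "countable \<B>" "topological_basis \<B>"
    using ex_countable_basis by blast
  then show ?thesis
    unfolding second_countable_def open_openin[symmetric]
    by (meson topological_basisE topological_basis_open)
qed

lemma open_Collect_apply: "open {P :: 'a \<Rightarrow> bool. P a}"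
  and closed_Collect_apply: "closed {P :: 'a \<Rightarrow> bool. P a}"
proof -
  have "continuous_on UNIV (\<lambda>P :: 'a \<Rightarrow> bool. P a)"
    by (rule continuous_on_product_coordinates)
  then have "open ((\<lambda>P :: 'a \<Rightarrow> bool. P a) -` B)" for B
    using open_discrete open_vimage by blast
  from this[of "{True}"] this[of "{False}"]
  show "open {P :: 'a \<Rightarrow> bool. P a}" "closed {P :: 'a \<Rightarrow> bool. P a}"
    by (auto simp: vimage_def closed_def Collect_neg_eq[symmetric])
qed

lemma card_of_nat_sets: "|UNIV :: nat set set| =o ctwo ^c natLeq"
  using card_of_Pow_Func[of "UNIV :: nat set"]
  by (simp add: ctwo_def cexp_def Field_natLeq Field_card_of)

text \<open>
  The family enters through its predicates, since the product topology lives on the function type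
  \<open>'a \<Rightarrow> bool\<close>. An uncountable family has at least \<open>2\<^bsup>\<aleph>\<^sub>0\<^esup>\<close> members by the perfect set argument and
  at most that many because its members are subsets of a countable type.
\<close>
lemma gdelta_in_countable_or_continuum:
  fixes \<S> :: "'a::countable set set"
  assumes S: "gdelta_in euclidean {P. Collect P \<in> \<S>}"
  shows "|\<S>| \<le>o natLeq \<or> |\<S>| =o ctwo ^c natLeq"
proof (cases "countable \<S>")
  case True
  then have "|\<S>| \<le>o |UNIV :: nat set|"
    by (auto simp: countable_def card_of_ordLeq[symmetric])
  then show ?thesis using card_of_nat ordLeq_ordIso_trans by blast
next
  case False
  let ?S = "{P. Collect P \<in> \<S>}"
  have bij: "bij_betw Collect ?S \<S>"
    by (intro bij_betwI[where g = "\<lambda>A x. x \<in> A"]) auto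
  then have "uncountable ?S"
    using False bij_betw_imp_surj_on by (metis countable_image)
  then have "(UNIV :: real set) \<lesssim> ?S"
    using uncountable_gdelta_in_reals_lepoll[OF completely_metrizable_space_predicates
        second_countable_euclidean S] by blast
  then have "(UNIV :: nat set set) \<lesssim> \<S>"
    using bij nat_sets_eqpoll_reals by (meson eqpoll_def lepoll_trans1 lepoll_trans2)
  then have "|UNIV :: nat set set| \<le>o |\<S>|"
    by (auto simp: lepoll_def card_of_ordLeq[symmetric])
  moreover have "|\<S>| \<le>o |UNIV :: nat set set|"
    by (intro card_of_ordLeqI[where f = "image to_nat"]) (auto simp: inj_on_def inj_image_eq_iff)
  ultimately have "|\<S>| =o |UNIV :: nat set set|"
    by (simp add: ordIso_iff_ordLeq)
  then show ?thesis
    using card_of_nat_sets ordIso_transitive by blast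
qed

section \<open>The fmp span is a \<open>G\<^sub>\<delta>\<close> set\<close>

instance fm :: (countable) countable
  by countable_datatype

text \<open>
  Each clause is a universally quantified chain of implications between memberships and constants,
  and membership of a fixed formula is a clopen condition.
\<close>
lemma closed_Collect_NExt:
  "closed {P :: 'p fm \<Rightarrow> bool. Collect P \<in> NExt L\<^sub>0}"
  unfolding NExt_def normal_logic_def subset_iff mem_Collect_eq
  by (intro closed_Collect_conj closed_Collect_all closed_Collect_imp open_Collect_const
      closed_Collect_const open_Collect_apply closed_Collect_apply)

lemma countable_finite_nat_frames:
  "countable {\<F> :: nat kframe. kripke_frame \<F> \<and> finite (fst \<F>)}"
proof (rule countable_subset)
  show "{\<F> :: nat kframe. kripke_frame \<F> \<and> finite (fst \<F>)} \<subseteq> Collect finite \<times> Collect finite"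
    using finite_subset by (fastforce simp: kripke_frame_def)
  show "countable (Collect finite \<times> Collect finite :: nat kframe set)"
    by (intro countable_SIGMA countable_Collect_finite)
qed

text \<open>
  Fixing whether \<open>\<F>\<close> validates a logic is closed when the answer is yes and open when it is no; in
  a metrizable space both are \<open>G\<^sub>\<delta>\<close>.
\<close>
lemma gdelta_in_same_validity:
  fixes \<F> :: "'w kframe" and b :: bool
  shows "gdelta_in euclidean {P :: 'p::countable fm \<Rightarrow> bool. (\<forall>\<phi>. P \<phi> \<longrightarrow> \<F> \<Turnstile> \<phi>) \<longleftrightarrow> b}"
proof (cases b)
  case True
  have "closed {P :: 'p fm \<Rightarrow> bool. \<forall>\<phi>. P \<phi> \<longrightarrow> \<F> \<Turnstile> \<phi>}"
    by (intro closed_Collect_all closed_Collect_imp closed_Collect_const open_Collect_apply)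
  with True show ?thesis
    by (simp add: closed_imp_gdelta_in_predicates)
next
  case False
  have "open {P :: 'p fm \<Rightarrow> bool. \<exists>\<phi>. P \<phi> \<and> \<not> \<F> \<Turnstile> \<phi>}"
    by (intro open_Collect_ex open_Collect_conj open_Collect_const open_Collect_apply)
  with False show ?thesis
    by (simp add: open_imp_gdelta_in)
qed

lemma gdelta_in_fmp_span:
  fixes L\<^sub>0 L :: "'p::countable fm set"
  shows "gdelta_in euclidean {P. Collect P \<in> fmp_span L\<^sub>0 L}"
proof -
  define Fin where "Fin = {\<F> :: nat kframe. kripke_frame \<F> \<and> finite (fst \<F>)}"
  define C where "C = {P :: 'p fm \<Rightarrow> bool. Collect P \<in> NExt L\<^sub>0}"
  define D where
    "D \<F> = {P :: 'p fm \<Rightarrow> bool. (\<forall>\<phi>. P \<phi> \<longrightarrow> \<F> \<Turnstile> \<phi>) \<longleftrightarrow> (\<forall>\<phi>\<in>L. \<F> \<Turnstile> \<phi>)}" for \<F> :: "nat kframe"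
  have "{P. Collect P \<in> fmp_span L\<^sub>0 L} = \<Inter>(insert C (D ` Fin))"
    by (auto simp: fmp_span_def FFr_def C_def D_def Fin_def set_eq_iff)
  moreover have "gdelta_in euclidean (\<Inter>(insert C (D ` Fin)))"
  proof (rule gdelta_in_Inter)
    show "countable (insert C (D ` Fin))"
      using countable_finite_nat_frames by (simp add: Fin_def)
    have "gdelta_in euclidean C"
      unfolding C_def by (intro closed_imp_gdelta_in_predicates closed_Collect_NExt)
    moreover have "gdelta_in euclidean (D \<F>)" for \<F>
      unfolding D_def by (rule gdelta_in_same_validity)
    ultimately show "gdelta_in euclidean S" if "S \<in> insert C (D ` Fin)" for S
      using that by blast
  qed simp
  ultimately show ?thesis by simp
qed

theorem theorem3p8:
  fixes L\<^sub>0 L :: "'p::countable fm set"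
  assumes "normal_logic L\<^sub>0"
    and "L \<in> NExt L\<^sub>0"
  shows "degree_of_fmp L\<^sub>0 L \<le>o natLeq \<or> degree_of_fmp L\<^sub>0 L =o ctwo ^c natLeq"
  unfolding degree_of_fmp_def
  using gdelta_in_fmp_span by (rule gdelta_in_countable_or_continuum)

end
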